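(* Let $n\ge 4$ and let $\mathbb F$ be a field. Every abstract $2$-rigidity matroid $M$ on $\binom{[n]}{2}$ that is representable over $\mathbb F$ can be represented by a standard two-dimensional infinitesimal rigidity matrix over $\mathbb F$; that is, there are points $p_1,\dots,p_n\in\mathbb F^2$ such that $M$ is the column matroid of $R(p_1,\dots,p_n)$.
   Context: Write $ij$ for $\{i,j\}\in\binom{[n]}{2}$, and for $T\subseteq[n]$ let $K_T=\binom{T}{2}$ be the edge set of the complete graph on $T$. An abstract $2$-rigidity matroid on $\binom{[n]}{2}$ is a matroid $M$ with ground set $\binom{[n]}{2}$ such that $\operatorname{rank}M=2n-3$ and, for every $T\subseteq[n]$ with $|T|=4$, $K_T$ is a circuit of $M$. Infinitesimal rigidity matrix (transposed): for points $p_i=(a_i,b_i)\in\mathbb F^2$, $i\in[n]$, the matrix $R(p_1,\dots,p_n)$ has rows $A_1,B_1,\dots,A_n,B_n$ and one column for each edge $ij\in\binom{[n]}{2}$; the column $ij$ with $i<j$ has entries $a_i-a_j,\ b_i-b_j,\ a_j-a_i,\ b_j-b_i$ in rows $A_i,B_i,A_j,B_j$ respectively, and all other entries zero. *)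

theory Defs
  imports "HOL-Library.Ramsey"
begin

locale matroid =
  fixes E :: "'e set" and \<I> :: "'e set set"
  assumes finite_ground: "finite E"
    and indep_subset_ground: "X \<in> \<I> \<Longrightarrow> X \<subseteq> E"
    and empty_indep: "{} \<in> \<I>"
    and indep_subset: "X \<in> \<I> \<Longrightarrow> Y \<subseteq> X \<Longrightarrow> Y \<in> \<I>"
    and augment: "X \<in> \<I> \<Longrightarrow> Y \<in> \<I> \<Longrightarrow> card X < card Y \<Longrightarrow> \<exists>y\<in>Y - X. insert y X \<in> \<I>"
begin

definition rank :: "'e set \<Rightarrow> nat" where
  "rank X = Max {card Y | Y. Y \<in> \<I> \<and> Y \<subseteq> X}"

definition circuit :: "'e set \<Rightarrow> bool" where
  "circuit C \<longleftrightarrow> C \<subseteq> E \<and> C \<notin> \<I> \<and> (\<forall>X. X \<subset> C \<longrightarrow> X \<in> \<I>)"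

end

text \<open>The vertex set is \<open>{1..n}\<close>, and the edge set of the complete graph on \<open>T\<close> is
  \<^term>\<open>nsets T 2\<close>, the set of two-element subsets of \<open>T\<close>.\<close>

locale abstract_2_rigidity_matroid =
  matroid "nsets {1..n} 2" \<I> for n :: nat and \<I> :: "nat set set set" +
  assumes rank_eq: "rank (nsets {1..n} 2) = 2 * n - 3"
    and K4_circuit: "T \<subseteq> {1..n} \<Longrightarrow> card T = 4 \<Longrightarrow> circuit (nsets T 2)"

text \<open>A matrix is a function \<open>A\<close> of a row and a column index, used with a row index set \<open>R\<close> and a
  (finite) column index set \<open>E\<close>. Linear independence is that of the family of columns indexed
  by \<open>X\<close>, so two equal columns with different indices are dependent.\<close>

definition columns_independent ::
    "'r set \<Rightarrow> ('r \<Rightarrow> 'e \<Rightarrow> 'f::field) \<Rightarrow> 'e set \<Rightarrow> bool" where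
  "columns_independent R A X \<longleftrightarrow>
     (\<forall>c :: 'e \<Rightarrow> 'f. (\<forall>r\<in>R. (\<Sum>e\<in>X. c e * A r e) = 0) \<longrightarrow> (\<forall>e\<in>X. c e = 0))"

text \<open>The independent sets of the column matroid.\<close>

definition column_matroid ::
    "'r set \<Rightarrow> 'e set \<Rightarrow> ('r \<Rightarrow> 'e \<Rightarrow> 'f::field) \<Rightarrow> 'e set set" where
  "column_matroid R E A = {X. X \<subseteq> E \<and> columns_independent R A X}"

definition representable_over :: "'f::field itself \<Rightarrow> 'e set \<Rightarrow> 'e set set \<Rightarrow> bool" where
  "representable_over F E \<I> \<longleftrightarrow>
     (\<exists>(m::nat) (A :: nat \<Rightarrow> 'e \<Rightarrow> 'f). \<I> = column_matroid {..<m} E A)"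

datatype rigidity_row = RowA nat | RowB nat

definition rigidity_rows :: "nat \<Rightarrow> rigidity_row set" where
  "rigidity_rows n = RowA ` {1..n} \<union> RowB ` {1..n}"

text \<open>For an edge \<open>e = {i, j}\<close> with \<open>i < j\<close> we have \<open>i = Min e\<close> and \<open>j = Max e\<close>.\<close>

fun rigidity_matrix :: "(nat \<Rightarrow> 'f::field \<times> 'f) \<Rightarrow> rigidity_row \<Rightarrow> nat set \<Rightarrow> 'f" where
  "rigidity_matrix p (RowA k) e =
     (let i = Min e; j = Max e in
      if k = i then fst (p i) - fst (p j)
      else if k = j then fst (p j) - fst (p i)
      else 0)"
| "rigidity_matrix p (RowB k) e =
     (let i = Min e; j = Max e in
      if k = i then snd (p i) - snd (p j)
      else if k = j then snd (p j) - snd (p i)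
      else 0)"

end

theory Submission
  imports Defs
begin

text \<open>The edges meeting \<open>{1, 2}\<close> form a basis \<open>B\<close>, and the fundamental circuit of an edge
  \<open>{i, j}\<close> with \<open>i, j \<ge> 3\<close> is the complete graph on \<open>{1, 2, i, j}\<close>. A representation is therefore
  determined, up to scaling the columns, by the dependencies \<open>\<omega> {i, j}\<close> on these circuits, normalised
  to be \<open>1\<close> at \<open>{1, 2}\<close>. Expanding the circuit on \<open>{1, 3, j, k}\<close> in terms of \<open>B\<close> forces
  \<open>\<omega> {i, j} {2, i} = t i / (x j - x i)\<close> for suitable \<open>x\<close> and \<open>t\<close>; in the same way
  \<open>\<omega> {i, j} {1, i} = s i / (y j - y i)\<close>. These are the stress coefficients of the points
  \<open>(1 : 0 : 0)\<close>, \<open>(0 : 1 : 0)\<close> and \<open>(x i : y i : 1)\<close> of the projective plane. A line missing all of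
  them exists over \<open>'f\<close>, and sending it to infinity yields the required points of the affine
  plane.\<close>

section \<open>Linear dependencies of columns\<close>

text \<open>Elements of the kernel of the matrix, extended by zero off \<open>E\<close>.
  Dependencies supported on different sets of columns thus live in one function space and can be
  added and subtracted freely.\<close>

definition dependency ::
    "'r set \<Rightarrow> 'e set \<Rightarrow> ('r \<Rightarrow> 'e \<Rightarrow> 'f::field) \<Rightarrow> ('e \<Rightarrow> 'f) \<Rightarrow> bool" where
  "dependency R E A c \<longleftrightarrow>
     (\<forall>e. e \<notin> E \<longrightarrow> c e = 0) \<and> (\<forall>r\<in>R. (\<Sum>e\<in>E. c e * A r e) = 0)"

lemma dependency_sum:
  assumes "\<And>s. s \<in> S \<Longrightarrow> dependency R E A (\<omega> s)"
  shows "dependency R E A (\<lambda>e. \<Sum>s\<in>S. k s * \<omega> s e)"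
proof -
  have "(\<Sum>e\<in>E. (\<Sum>s\<in>S. k s * \<omega> s e) * A r e) = 0" if r: "r \<in> R" for r
  proof -
    have "(\<Sum>e\<in>E. (\<Sum>s\<in>S. k s * \<omega> s e) * A r e)
        = (\<Sum>e\<in>E. \<Sum>s\<in>S. k s * (\<omega> s e * A r e))"
      by (simp add: sum_distrib_right mult.assoc)
    also have "\<dots> = (\<Sum>s\<in>S. k s * (\<Sum>e\<in>E. \<omega> s e * A r e))"
      by (subst sum.swap) (simp add: sum_distrib_left)
    also have "\<dots> = 0"
      using assms r by (intro sum.neutral) (simp add: dependency_def)
    finally show ?thesis .
  qed
  moreover have "(\<Sum>s\<in>S. k s * \<omega> s e) = 0" if "e \<notin> E" for e
    using assms that by (intro sum.neutral) (simp add: dependency_def)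
  ultimately show ?thesis
    by (simp add: dependency_def)
qed

lemma dependency_diff:
  assumes "dependency R E A c" "dependency R E A d"
  shows "dependency R E A (\<lambda>e. c e - d e)"
  using assms by (simp add: dependency_def left_diff_distrib sum_subtractf)

lemma dependency_add:
  assumes "dependency R E A c" "dependency R E A d"
  shows "dependency R E A (\<lambda>e. c e + d e)"
  using assms by (simp add: dependency_def distrib_right sum.distrib)

lemma dependency_scale:
  assumes "dependency R E A c"
  shows "dependency R E A (\<lambda>e. k * c e)"
  using assms by (simp add: dependency_def mult.assoc flip: sum_distrib_left)

lemma columns_independent_iff_dependency:
  assumes "finite E" "X \<subseteq> E"
  shows "columns_independent R A X \<longleftrightarrow>
    (\<forall>c. dependency R E A c \<longrightarrow> (\<forall>e. e \<notin> X \<longrightarrow> c e = 0) \<longrightarrow> (\<forall>e. c e = 0))"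
    (is "?L \<longleftrightarrow> ?R")
proof
  assume L: ?L
  show ?R
  proof (intro allI impI)
    fix c e
    assume c: "dependency R E A c" and 0: "\<forall>e. e \<notin> X \<longrightarrow> c e = 0"
    have "(\<Sum>e\<in>X. c e * A r e) = 0" if "r \<in> R" for r
    proof -
      have "(\<Sum>e\<in>X. c e * A r e) = (\<Sum>e\<in>E. c e * A r e)"
        using assms 0 by (intro sum.mono_neutral_left) auto
      with c that show ?thesis
        by (simp add: dependency_def)
    qed
    with L have "\<forall>e\<in>X. c e = 0"
      by (auto simp: columns_independent_def)
    with 0 show "c e = 0"
      by blast
  qed
next
  assume R: ?R
  show ?L
    unfolding columns_independent_def
  proof (intro allI impI)
    fix c :: "_ \<Rightarrow> 'c"
    assume c: "\<forall>r\<in>R. (\<Sum>e\<in>X. c e * A r e) = 0"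
    let ?c = "\<lambda>e. if e \<in> X then c e else 0"
    have "(\<Sum>e\<in>E. ?c e * A r e) = (\<Sum>e\<in>X. c e * A r e)" for r
      using assms by (intro sum.mono_neutral_cong_right) auto
    with c assms have "dependency R E A ?c"
      by (auto simp: dependency_def)
    with R have "?c e = 0" for e
      by (elim allE[where x = ?c]) simp
    then show "\<forall>e\<in>X. c e = 0"
      by metis
  qed
qed

lemma dependency_eq_0:
  assumes "finite E" "X \<subseteq> E" "columns_independent R A X"
    and "dependency R E A c" "\<And>e. e \<in> E - X \<Longrightarrow> c e = 0"
  shows "c e = 0"
proof -
  have "c e = 0" if "e \<notin> X" for e
    using assms that by (cases "e \<in> E") (auto simp: dependency_def)
  with assms show ?thesis
    using columns_independent_iff_dependency by metis
qed

lemma not_columns_independentE: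
  assumes "finite E" "X \<subseteq> E" "\<not> columns_independent R A X"
  obtains c e where "dependency R E A c" "\<And>e. e \<notin> X \<Longrightarrow> c e = 0" "e \<in> X" "c e \<noteq> 0"
  using assms columns_independent_iff_dependency by metis

text \<open>Each \<open>\<omega> e\<close> meets the complement of \<open>B\<close> only in
  \<open>e\<close>. Subtracting from \<open>c\<close> the combination \<open>d\<close> that agrees
  with it off \<open>B\<close> leaves a dependency supported on the independent set
  \<open>B\<close>, that is, zero. So the \<open>\<omega> e\<close> span all dependencies of
  \<open>A\<close>, and they are dependencies of \<open>A'\<close> as well.\<close>

lemma dependency_transfer:
  assumes "finite E" "B \<subseteq> E" "columns_independent R A B"
    and \<omega>: "\<And>e. e \<in> E - B \<Longrightarrow> dependency R E A (\<omega> e)"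
      "\<And>e. e \<in> E - B \<Longrightarrow> dependency R' E A' (\<omega> e)"
      "\<And>e. e \<in> E - B \<Longrightarrow> \<omega> e e \<noteq> 0"
      "\<And>e f. e \<in> E - B \<Longrightarrow> f \<in> E - B \<Longrightarrow> e \<noteq> f \<Longrightarrow> \<omega> e f = 0"
    and c: "dependency R E A c"
  shows "dependency R' E A' c"
proof -
  define d where "d f = (\<Sum>e\<in>E - B. c e / \<omega> e e * \<omega> e f)" for f
  have d: "dependency R E A d" "dependency R' E A' d"
    unfolding d_def by (intro dependency_sum \<omega>; simp)+
  have "c f - d f = 0" for f
  proof (rule dependency_eq_0[OF assms(1-3)])
    show "dependency R E A (\<lambda>f. c f - d f)"
      using c d(1) by (rule dependency_diff)
    fix f assume f: "f \<in> E - B"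
    have "d f = (\<Sum>e\<in>E - B. if e = f then c f else 0)"
      unfolding d_def using \<omega>(3,4) f by (intro sum.cong) auto
    then show "c f - d f = 0"
      using f assms(1) by simp
  qed
  then have "c = d"
    by auto
  with d show ?thesis
    by simp
qed

text \<open>Transfer in both directions shows that the two matrices have the same dependencies, and
  these determine which sets of columns are independent.\<close>

lemma column_matroid_eqI:
  assumes "finite E" "B \<subseteq> E" "columns_independent R A B" "columns_independent R' A' B"
    and "\<And>e. e \<in> E - B \<Longrightarrow> dependency R E A (\<omega> e)"
      "\<And>e. e \<in> E - B \<Longrightarrow> dependency R' E A' (\<omega> e)"
      "\<And>e. e \<in> E - B \<Longrightarrow> \<omega> e e \<noteq> 0"
      "\<And>e f. e \<in> E - B \<Longrightarrow> f \<in> E - B \<Longrightarrow> e \<noteq> f \<Longrightarrow> \<omega> e f = 0"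
  shows "column_matroid R E A = column_matroid R' E A'"
proof -
  have "dependency R E A c \<longleftrightarrow> dependency R' E A' c" for c
    using dependency_transfer[OF assms(1-3,5-8)] dependency_transfer[OF assms(1,2,4,6,5,7,8)]
    by auto
  then have "columns_independent R A X \<longleftrightarrow> columns_independent R' A' X" if "X \<subseteq> E" for X
    using that assms(1) by (simp add: columns_independent_iff_dependency)
  then show ?thesis
    unfolding column_matroid_def by blast
qed

lemma columns_independent_scale:
  assumes "\<And>e. e \<in> X \<Longrightarrow> \<mu> e \<noteq> 0"
  shows "columns_independent R (\<lambda>r e. \<mu> e * A r e) X \<longleftrightarrow> columns_independent R A X"
    (is "?L \<longleftrightarrow> ?R")
proof
  assume L: ?L
  show ?R
    unfolding columns_independent_def
  proof (intro allI impI)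
    fix c assume c: "\<forall>r\<in>R. (\<Sum>e\<in>X. c e * A r e) = 0"
    have "(\<Sum>e\<in>X. c e / \<mu> e * (\<mu> e * A r e)) = (\<Sum>e\<in>X. c e * A r e)" for r
      using assms by (intro sum.cong) auto
    with L c have "\<forall>e\<in>X. c e / \<mu> e = 0"
      unfolding columns_independent_def by (elim allE[where x = "\<lambda>e. c e / \<mu> e"]) simp
    with assms show "\<forall>e\<in>X. c e = 0"
      by simp
  qed
next
  assume R: ?R
  show ?L
    unfolding columns_independent_def
  proof (intro allI impI)
    fix c assume "\<forall>r\<in>R. (\<Sum>e\<in>X. c e * (\<mu> e * A r e)) = 0"
    then have "\<forall>e\<in>X. c e * \<mu> e = 0"
      using R unfolding columns_independent_def
      by (elim allE[where x = "\<lambda>e. c e * \<mu> e"]) (simp add: mult.assoc)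
    with assms show "\<forall>e\<in>X. c e = 0"
      by simp
  qed
qed

lemma column_matroid_scale:
  assumes "\<And>e. e \<in> E \<Longrightarrow> \<mu> e \<noteq> 0"
  shows "column_matroid R E (\<lambda>r e. \<mu> e * A r e) = column_matroid R E A"
  using columns_independent_scale[of _ \<mu> R A] assms
  unfolding column_matroid_def by (auto simp: subset_iff)

text \<open>A dependency on \<open>C\<close> that vanished at some \<open>f\<close> in
  \<open>C\<close> would live on the independent set \<open>C - {f}\<close>, so its support is all
  of \<open>C\<close>.\<close>

lemma circuit_dependency:
  assumes "matroid E \<I>" "\<I> = column_matroid R E A" "matroid.circuit E \<I> C"
  obtains c where "dependency R E A c" "\<And>e. c e \<noteq> 0 \<longleftrightarrow> e \<in> C"
proof -
  interpret matroid E \<I> by fact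
  have C: "C \<subseteq> E" "C \<notin> \<I>" "\<And>X. X \<subset> C \<Longrightarrow> X \<in> \<I>"
    using assms(3) by (auto simp: circuit_def)
  then have "\<not> columns_independent R A C"
    using assms(2) by (auto simp: column_matroid_def)
  then obtain c e where c: "dependency R E A c" "\<And>e. e \<notin> C \<Longrightarrow> c e = 0" "c e \<noteq> 0"
    using not_columns_independentE[OF finite_ground C(1)] by metis
  have "c f \<noteq> 0" if f: "f \<in> C" for f
  proof
    assume "c f = 0"
    have "columns_independent R A (C - {f})"
      using C(3)[of "C - {f}"] f assms(2) by (auto simp: column_matroid_def)
    from dependency_eq_0[OF finite_ground _ this c(1)] have "c e = 0"
      using C(1) c(2) \<open>c f = 0\<close> by auto
    with c(3) show False by simp
  qed
  with c that show ?thesis by blast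
qed

text \<open>The \<open>\<omega> e\<close> express every column outside \<open>B\<close> through
  \<open>B\<close>. A spanning set with at most \<open>rank E\<close> elements is a basis: otherwise
  a maximal independent \<open>X\<close> inside \<open>B\<close> could be augmented by some
  \<open>y\<close> outside \<open>B\<close>, although \<open>y\<close> depends on
  \<open>X\<close>.\<close>

lemma spanning_columns_independent:
  assumes "matroid E \<I>" "\<I> = column_matroid R E A" "B \<subseteq> E" "card B \<le> matroid.rank \<I> E"
    and \<omega>: "\<And>e. e \<in> E - B \<Longrightarrow> dependency R E A (\<omega> e)"
      "\<And>e. e \<in> E - B \<Longrightarrow> \<omega> e e \<noteq> 0"
      "\<And>e f. e \<in> E - B \<Longrightarrow> f \<in> E - B \<Longrightarrow> e \<noteq> f \<Longrightarrow> \<omega> e f = 0"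
  shows "columns_independent R A B"
proof -
  interpret matroid E \<I> by fact
  have finB: "finite B"
    using finite_ground assms(3) finite_subset by blast
  have "finite (Pow E)"
    using finite_ground by simp
  then have "finite {card Y | Y. Y \<in> \<I> \<and> Y \<subseteq> E}"
    by (rule finite_surj[of _ _ card]) auto
  then have "rank E \<in> {card Y | Y. Y \<in> \<I> \<and> Y \<subseteq> E}"
    unfolding rank_def using empty_indep by (intro Max_in) auto
  then obtain Y where Y: "Y \<in> \<I>" "card Y = rank E"
    by auto
  obtain X where X: "X \<in> \<I>" "X \<subseteq> B"
    and max: "\<And>Z. Z \<in> \<I> \<Longrightarrow> Z \<subseteq> B \<Longrightarrow> X \<subseteq> Z \<Longrightarrow> Z = X"
  proof -
    have "finite {Z \<in> \<I>. Z \<subseteq> B}" "{Z \<in> \<I>. Z \<subseteq> B} \<noteq> {}"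
      using finB empty_indep by auto
    from finite_has_maximal[OF this] obtain X where "X \<in> \<I>" "X \<subseteq> B"
        "\<forall>Z\<in>{Z \<in> \<I>. Z \<subseteq> B}. X \<subseteq> Z \<longrightarrow> X = Z"
      by auto
    then show ?thesis
      by (intro that) auto
  qed
  have indX: "columns_independent R A X"
    using X assms(2) by (simp add: column_matroid_def)
  have "X = B"
  proof (rule ccontr)
    assume "X \<noteq> B"
    with X finB have "card X < card B"
      by (intro psubset_card_mono) auto
    with assms(4) Y have "card X < card Y" by simp
    then obtain y where y: "y \<in> Y - X" "insert y X \<in> \<I>"
      using augment X(1) Y(1) by blast
    have yE: "y \<in> E - B"
      using max[OF y(2)] y X(2) indep_subset_ground[OF y(2)] by blast
    \<comment> \<open>By maximality of \<open>X\<close>, each remaining column \<open>b\<close> of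
      \<open>B\<close> is a combination of the columns in \<open>X\<close>.\<close>
    have "\<exists>d. dependency R E A d \<and> (\<forall>e. e \<notin> insert b X \<longrightarrow> d e = 0) \<and> d b \<noteq> 0"
      if b: "b \<in> B - X" for b
    proof -
      have sub: "insert b X \<subseteq> E"
        using b X(2) assms(3) by auto
      have "insert b X \<notin> \<I>"
        using max[of "insert b X"] b X(2) by blast
      then have "\<not> columns_independent R A (insert b X)"
        using sub assms(2) by (simp add: column_matroid_def)
      then obtain d e where d: "dependency R E A d" "\<And>e. e \<notin> insert b X \<Longrightarrow> d e = 0" "d e \<noteq> 0"
        using not_columns_independentE[OF finite_ground sub] by metis
      have "d b \<noteq> 0"
      proof
        assume "d b = 0"
        with d(2) have "d f = 0" if "f \<in> E - X" for f
          using that by (cases "f = b") auto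
        then have "d e = 0"
          using sub dependency_eq_0[OF finite_ground _ indX d(1)] by simp
        with d(3) show False by simp
      qed
      with d show ?thesis by blast
    qed
    then have "\<forall>b\<in>B - X. \<exists>d. dependency R E A d \<and> (\<forall>e. e \<notin> insert b X \<longrightarrow> d e = 0) \<and> d b \<noteq> 0"
      by blast
    from bchoice[OF this] obtain d where d: "\<And>b. b \<in> B - X \<Longrightarrow> dependency R E A (d b)"
        "\<And>b e. b \<in> B - X \<Longrightarrow> e \<notin> insert b X \<Longrightarrow> d b e = 0"
        "\<And>b. b \<in> B - X \<Longrightarrow> d b b \<noteq> 0"
      by blast
    \<comment> \<open>Substituting these combinations into \<open>\<omega> y\<close> eliminates
      \<open>B - X\<close> and leaves a dependency on \<open>insert y X\<close> whose coefficient at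
      \<open>y\<close> is still \<open>\<omega> y y\<close>.\<close>
    define c where "c f = \<omega> y f - (\<Sum>b\<in>B - X. \<omega> y b / d b b * d b f)" for f
    have "dependency R E A c"
      unfolding c_def using d(1) \<omega>(1) yE by (intro dependency_diff dependency_sum) auto
    moreover have "c f = 0" if f: "f \<in> E - insert y X" for f
    proof (cases "f \<in> B")
      case True
      have "(\<Sum>b\<in>B - X. \<omega> y b / d b b * d b f) = (\<Sum>b\<in>B - X. if b = f then \<omega> y f else 0)"
        using d(2,3) f by (intro sum.cong) auto
      with True f finB show ?thesis
        by (simp add: c_def)
    next
      case False
      then have "d b f = 0" if "b \<in> B - X" for b
        using f \<open>f \<notin> B\<close> that by (intro d(2)) auto
      then have "(\<Sum>b\<in>B - X. \<omega> y b / d b b * d b f) = 0"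
        by simp
      with \<omega>(3)[of y f] yE f False show ?thesis
        by (auto simp: c_def)
    qed
    moreover have "columns_independent R A (insert y X)" "insert y X \<subseteq> E"
      using y(2) assms(2) by (auto simp: column_matroid_def)
    ultimately have "c y = 0"
      by (metis dependency_eq_0[OF finite_ground])
    moreover have "d b y = 0" if "b \<in> B - X" for b
      using y(1) yE that by (intro d(2)) auto
    ultimately have "\<omega> y y = 0"
      by (simp add: c_def)
    with \<omega>(2) yE show False by blast
  qed
  with indX show ?thesis by simp
qed

section \<open>Stresses of planar frameworks\<close>

lemma doubleton_mem_nsets_2: "{k, l} \<in> nsets V 2 \<longleftrightarrow> k \<noteq> l \<and> k \<in> V \<and> l \<in> V"
  by (auto simp: nsets_def card_insert_if)

lemma rigidity_matrix_doubleton: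
  assumes "k \<noteq> l"
  shows "rigidity_matrix p (RowA k) {k, l} = fst (p k) - fst (p l)"
    and "rigidity_matrix p (RowB k) {k, l} = snd (p k) - snd (p l)"
proof -
  have "Min {k, l} = k \<and> Max {k, l} = l \<or> Min {k, l} = l \<and> Max {k, l} = k"
    by (simp add: min_def max_def)
  with assms show "rigidity_matrix p (RowA k) {k, l} = fst (p k) - fst (p l)"
    "rigidity_matrix p (RowB k) {k, l} = snd (p k) - snd (p l)"
    by (elim disjE; simp only: rigidity_matrix.simps Let_def; simp)+
qed

lemma rigidity_matrix_notin:
  assumes "e \<in> nsets V 2" "k \<notin> e"
  shows "rigidity_matrix p (RowA k) e = 0" "rigidity_matrix p (RowB k) e = 0"
proof -
  have "finite e" "e \<noteq> {}"
    using assms(1) by (auto simp: nsets_def)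
  then have "Min e \<in> e" "Max e \<in> e"
    by auto
  with assms(2) show "rigidity_matrix p (RowA k) e = 0" "rigidity_matrix p (RowB k) e = 0"
    by (auto simp: Let_def)
qed

lemma sum_edges_at_vertex:
  assumes "finite V" "X \<subseteq> nsets V 2" and 0: "\<And>e. e \<in> X \<Longrightarrow> k \<notin> e \<Longrightarrow> f e = 0"
  shows "(\<Sum>e\<in>X. f e) = (\<Sum>l | {k, l} \<in> X. f {k, l})"
proof -
  have fin: "finite X"
    using assms(1,2) finite_imp_finite_nsets finite_subset by blast
  have im: "(\<lambda>l. {k, l}) ` {l. {k, l} \<in> X} = {e \<in> X. k \<in> e}"
  proof (intro subset_antisym subsetI)
    fix e assume e: "e \<in> {e \<in> X. k \<in> e}"
    then have "card e = 2"
      using assms(2) by (auto simp: nsets_def)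
    then obtain a b where "e = {a, b}"
      by (auto simp: card_2_iff)
    with e show "e \<in> (\<lambda>l. {k, l}) ` {l. {k, l} \<in> X}"
      by (auto simp: insert_commute)
  qed auto
  have "(\<Sum>e\<in>X. f e) = (\<Sum>e | e \<in> X \<and> k \<in> e. f e)"
    using fin 0 by (intro sum.mono_neutral_right) auto
  also have "\<dots> = (\<Sum>l | {k, l} \<in> X. f {k, l})"
    unfolding im[symmetric]
    by (subst sum.reindex) (auto simp: inj_on_def doubleton_eq_iff)
  finally show ?thesis .
qed

text \<open>The row equations at \<open>k\<close> become the equilibrium of the stress
  \<open>c\<close> at vertex \<open>k\<close>, as a sum over the neighbours of \<open>k\<close> in
  \<open>X\<close>.\<close>

lemma sum_rigidity_matrix:
  assumes "finite V" "X \<subseteq> nsets V 2"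
  shows "(\<Sum>e\<in>X. c e * rigidity_matrix p (RowA k) e)
      = (\<Sum>l | {k, l} \<in> X. c {k, l} * (fst (p k) - fst (p l)))"
    and "(\<Sum>e\<in>X. c e * rigidity_matrix p (RowB k) e)
      = (\<Sum>l | {k, l} \<in> X. c {k, l} * (snd (p k) - snd (p l)))"
proof -
  have ne: "k \<noteq> l" if "{k, l} \<in> X" for l
    using subsetD[OF assms(2) that] by (simp add: doubleton_mem_nsets_2)
  have 0: "c e * rigidity_matrix p (RowA k) e = 0" "c e * rigidity_matrix p (RowB k) e = 0"
    if "e \<in> X" "k \<notin> e" for e
    by (simp_all only: rigidity_matrix_notin[OF subsetD[OF assms(2) that(1)] that(2)] mult_zero_right)
  show "(\<Sum>e\<in>X. c e * rigidity_matrix p (RowA k) e)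
      = (\<Sum>l | {k, l} \<in> X. c {k, l} * (fst (p k) - fst (p l)))"
    by (subst sum_edges_at_vertex[OF assms 0(1)], assumption, assumption, intro sum.cong refl)
      (simp only: mem_Collect_eq rigidity_matrix_doubleton[OF ne])
  show "(\<Sum>e\<in>X. c e * rigidity_matrix p (RowB k) e)
      = (\<Sum>l | {k, l} \<in> X. c {k, l} * (snd (p k) - snd (p l)))"
    by (subst sum_edges_at_vertex[OF assms 0(2)], assumption, assumption, intro sum.cong refl)
      (simp only: mem_Collect_eq rigidity_matrix_doubleton[OF ne])
qed

lemma affine_dependency_stress_sum:
  fixes \<alpha> x :: "nat \<Rightarrow> 'f::field"
  assumes "finite T" "(\<Sum>l\<in>T. \<alpha> l) = 0" "(\<Sum>l\<in>T. \<alpha> l * x l) = 0"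
  shows "(\<Sum>l | {k, l} \<in> nsets T 2. (\<Prod>i\<in>{k, l}. \<alpha> i) * (x k - x l)) = 0"
proof (cases "k \<in> T")
  case True
  then have "{l. {k, l} \<in> nsets T 2} = T - {k}"
    by (auto simp: doubleton_mem_nsets_2)
  then have "(\<Sum>l | {k, l} \<in> nsets T 2. (\<Prod>i\<in>{k, l}. \<alpha> i) * (x k - x l))
      = (\<Sum>l\<in>T - {k}. \<alpha> k * \<alpha> l * (x k - x l))"
    by (intro sum.cong) auto
  also have "\<dots> = (\<Sum>l\<in>T. \<alpha> k * \<alpha> l * (x k - x l))"
    using assms(1) by (intro sum.mono_neutral_left) auto
  also have "\<dots> = \<alpha> k * x k * (\<Sum>l\<in>T. \<alpha> l) - \<alpha> k * (\<Sum>l\<in>T. \<alpha> l * x l)"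
    by (simp add: sum_distrib_left algebra_simps sum_subtractf)
  finally show ?thesis
    using assms by simp
next
  case False
  then have "{l. {k, l} \<in> nsets T 2} = {}"
    by (auto simp: doubleton_mem_nsets_2)
  then show ?thesis
    by (simp only: sum.empty)
qed

text \<open>The products of the coefficients of an affine dependency form a self-stress of the
  complete graph: at vertex \<open>k\<close> the force is \<open>\<alpha> k\<close> times a
  combination of the two sums that vanish. On four points this gives the stress of \<open>K4\<close>
  explicitly.\<close>

lemma affine_dependency_stress:
  assumes "finite T" "(\<Sum>l\<in>T. \<alpha> l) = 0"
    and "(\<Sum>l\<in>T. \<alpha> l * fst (p l)) = 0" "(\<Sum>l\<in>T. \<alpha> l * snd (p l)) = 0"
  shows "(\<Sum>e\<in>nsets T 2. (\<Prod>i\<in>e. \<alpha> i) * rigidity_matrix p r e) = 0"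
  by (cases r)
    (simp_all only: sum_rigidity_matrix[OF assms(1) subset_refl]
      affine_dependency_stress_sum[OF assms(1,2,3)] affine_dependency_stress_sum[OF assms(1,2,4)])

lemma edge_cases:
  fixes V :: "nat set"
  assumes "e \<in> nsets V 2"
  obtains i j where "e = {i, j}" "i < j" "i \<in> V" "j \<in> V"
proof -
  from assms obtain i j where ij: "e = {i, j}" "i \<noteq> j" "i \<in> V" "j \<in> V"
    by (auto simp: nsets_def card_2_iff)
  show ?thesis
  proof (cases "i < j")
    case True
    with ij that show ?thesis by blast
  next
    case False
    with ij that[of j i] show ?thesis by (simp add: insert_commute)
  qed
qed

text \<open>The line through \<open>p 1\<close> and \<open>p 2\<close> is
  \<open>a * X + b * Y = 1\<close>, and no other point lies on it. A vertex \<open>k \<ge> 3\<close>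
  has only the neighbours \<open>1\<close> and \<open>2\<close>, in different directions, so
  equilibrium at \<open>k\<close> kills both edges. Only the edge \<open>{1, 2}\<close> is then
  left.\<close>

lemma columns_independent_rigidity_matrix:
  fixes p :: "nat \<Rightarrow> 'f::field \<times> 'f"
  assumes "n \<ge> 2" "a \<noteq> 0" "b \<noteq> 0" "p 1 = (1 / a, 0)" "p 2 = (0, 1 / b)"
    and "\<And>k. k \<in> {3..n} \<Longrightarrow> a * fst (p k) + b * snd (p k) \<noteq> 1"
  shows "columns_independent (rigidity_rows n) (rigidity_matrix p)
    (nsets {1..n} 2 - nsets {3..n} 2)" (is "columns_independent _ _ ?B")
  unfolding columns_independent_def
proof (intro allI impI ballI)
  fix c e
  assume c: "\<forall>r\<in>rigidity_rows n. (\<Sum>e\<in>?B. c e * rigidity_matrix p r e) = 0" and e: "e \<in> ?B"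
  have mem: "{k, l} \<in> ?B \<longleftrightarrow> k \<noteq> l \<and> k \<in> {1..n} \<and> l \<in> {1..n} \<and> (k \<le> 2 \<or> l \<le> 2)" for k l
    by (auto simp: doubleton_mem_nsets_2)
  have rows: "RowA k \<in> rigidity_rows n" "RowB k \<in> rigidity_rows n" if "k \<in> {1..n}" for k
    using that by (auto simp: rigidity_rows_def)
  have sumA: "(\<Sum>l | {k, l} \<in> ?B. c {k, l} * (fst (p k) - fst (p l))) = 0"
    and sumB: "(\<Sum>l | {k, l} \<in> ?B. c {k, l} * (snd (p k) - snd (p l))) = 0"
    if "k \<in> {1..n}" for k
    using c rows[OF that] sum_rigidity_matrix[of "{1..n}" ?B c p k] by auto
  have 3: "c {k, 1} = 0 \<and> c {k, 2} = 0" if k: "k \<in> {3..n}" for k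
  proof -
    have N: "{l. {k, l} \<in> ?B} = {1, 2}"
      using k assms(1) by (auto simp: mem)
    define u v X Y where uv: "u = c {k, 1}" "v = c {k, 2}" "X = fst (p k)" "Y = snd (p k)"
    have eqs: "u * (X - 1 / a) + v * X = 0" "u * Y + v * (Y - 1 / b) = 0"
      using sumA[of k] sumB[of k] k assms(4,5) unfolding N by (simp_all add: uv)
    \<comment> \<open>This is \<open>a * b\<close> times the determinant of the linear system
      \<open>eqs\<close> in \<open>u\<close> and \<open>v\<close>. The two identities that follow
      are Cramer's rule.\<close>
    have ne: "1 - a * X - b * Y \<noteq> 0"
      using assms(6)[OF k] by (auto simp: uv algebra_simps)
    have "u * (1 - a * X - b * Y)
        = a * b * ((Y - 1 / b) * (u * (X - 1 / a) + v * X) - X * (u * Y + v * (Y - 1 / b)))"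
      using assms(2,3) by (simp add: field_simps)
    then have "u * (1 - a * X - b * Y) = 0"
      unfolding eqs by simp
    moreover have "v * (1 - a * X - b * Y)
        = a * b * ((X - 1 / a) * (u * Y + v * (Y - 1 / b)) - Y * (u * (X - 1 / a) + v * X))"
      using assms(2,3) by (simp add: field_simps)
    then have "v * (1 - a * X - b * Y) = 0"
      unfolding eqs by simp
    ultimately show ?thesis
      using ne by (simp add: uv)
  qed
  \<comment> \<open>The first coordinates of \<open>p 1\<close> and \<open>p 2\<close> differ by
    \<open>1 / a\<close>, so the row \<open>RowA 1\<close> detects this last coefficient.\<close>
  have 12: "c {1, 2} = 0"
  proof -
    have N: "{l. {1, l} \<in> ?B} = {2..n}"
      by (auto simp: mem)
    have "(\<Sum>l\<in>{2..n}. c {1, l} * (fst (p 1) - fst (p l)))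
        = (\<Sum>l\<in>{2}. c {1, l} * (fst (p 1) - fst (p l)))"
    proof (intro sum.mono_neutral_right ballI)
      fix l assume "l \<in> {2..n} - {2}"
      then have "c {l, 1} = 0"
        using 3 by auto
      then show "c {1, l} * (fst (p 1) - fst (p l)) = 0"
        by (simp add: insert_commute)
    qed (use assms(1) in auto)
    then show ?thesis
      using sumA[of 1] assms(1,2,4,5) unfolding N by simp
  qed
  from e obtain i j where ij: "e = {i, j}" "i < j" "i \<in> {1..n}" "j \<in> {1..n}"
    using edge_cases[of e "{1..n}"] by blast
  then have "i = 1 \<or> i = 2"
    using e mem[of i j] by auto
  with ij 12 3[of j] show "c e = 0"
    by (cases "j = 2") (auto simp: insert_commute)
qed

section \<open>Points in general position\<close>

text \<open>The solution is normalised by \<open>x z = 0\<close> and \<open>t z = 1\<close>, which leaves no choice for \<open>x\<close> and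
  \<open>t\<close>.\<close>

lemma reciprocal_differences:
  fixes q :: "nat \<Rightarrow> nat \<Rightarrow> 'f::field"
  assumes "z \<in> I" and q: "\<And>i j. i \<in> I \<Longrightarrow> j \<in> I \<Longrightarrow> i \<noteq> j \<Longrightarrow> q i j \<noteq> 0"
    and eq1: "\<And>j k. j \<in> I - {z} \<Longrightarrow> k \<in> I - {z} \<Longrightarrow> j \<noteq> k \<Longrightarrow> q z j / q z k + q j z / q j k = 1"
  shows "\<exists>x t. x z = 0 \<and> (\<forall>i\<in>I. t i \<noteq> 0) \<and>
    (\<forall>i\<in>I. \<forall>j\<in>I. i \<noteq> j \<longrightarrow> t i = q i j * (x j - x i))"
proof -
  \<comment> \<open>Putting \<open>i = z\<close> and then \<open>j = z\<close> into the desired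
    equation \<open>t i = q i j * (x j - x i)\<close> forces these formulas.\<close>
  define x where "x k = (if k = z then 0 else 1 / q z k)" for k
  define t where "t k = (if k = z then 1 else - (q k z / q z k))" for k
  have "t i = q i j * (x j - x i)" if ij: "i \<in> I" "j \<in> I" "i \<noteq> j" for i j
  proof -
    consider "i = z" | "j = z" | "i \<noteq> z" "j \<noteq> z" by blast
    then show ?thesis
    proof cases
      case 3
      \<comment> \<open>Multiplied by \<open>q z i / q i j\<close>, the claim becomes
        \<open>eq1\<close> for the pair \<open>i\<close>, \<open>j\<close>.\<close>
      have "q z i \<noteq> 0" "q z j \<noteq> 0" "q i j \<noteq> 0"
        using q assms(1) ij 3 by auto
      with eq1[of i j] ij 3 show ?thesis
        by (simp add: x_def t_def field_simps)
    qed (use q assms(1) ij in \<open>auto simp: x_def t_def\<close>)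
  qed
  moreover have "x z = 0" "\<And>i. i \<in> I \<Longrightarrow> t i \<noteq> 0"
    using q assms(1) by (auto simp: x_def t_def)
  ultimately show ?thesis
    by blast
qed

text \<open>The line passes through the intersection of the line joining the points \<open>1\<close> and \<open>2\<close> with the
  line joining the points \<open>3\<close> and \<open>4\<close>. Since the latter pair forbids only one value of \<open>c\<close>, there
  are at most \<open>n - 3\<close> forbidden values, whereas the \<open>x i\<close> are \<open>n - 2\<close> distinct field elements;
  this covers finite fields too small for a generic choice.\<close>

lemma line_avoiding_points:
  fixes x y :: "nat \<Rightarrow> 'f::field"
  assumes "n \<ge> 4" "inj_on x {3..n}" "inj_on y {3..n}" "x 3 = 0" "y 3 = 0"
  obtains a b c where "a \<noteq> 0" "b \<noteq> 0" "c \<noteq> 0" "\<And>i. i \<in> {3..n} \<Longrightarrow> a * x i + b * y i + c \<noteq> 0"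
proof -
  have "x 4 \<noteq> x 3" "y 4 \<noteq> y 3"
    using assms inj_onD[of x "{3..n}" 4 3] inj_onD[of y "{3..n}" 4 3] by auto
  with assms(4,5) have 4: "x 4 \<noteq> 0" "y 4 \<noteq> 0"
    by auto
  \<comment> \<open>The form \<open>a * X + b * Y\<close> vanishes at both points \<open>3\<close>
    and \<open>4\<close>, which therefore exclude the same value of \<open>c\<close>.\<close>
  define a b where ab: "a = 1 / x 4" "b = - (1 / y 4)"
  define F where "F = (\<lambda>i. - (a * x i + b * y i)) ` {3..n}"
  have 34: "a * x 3 + b * y 3 = a * x 4 + b * y 4"
    using assms(4,5) 4 by (simp add: ab)
  have "F \<subseteq> (\<lambda>i. - (a * x i + b * y i)) ` ({3..n} - {4})"
  proof
    fix v assume "v \<in> F"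
    then obtain i where i: "i \<in> {3..n}" "v = - (a * x i + b * y i)"
      unfolding F_def by blast
    show "v \<in> (\<lambda>i. - (a * x i + b * y i)) ` ({3..n} - {4})"
    proof (cases "i = 4")
      case True
      with i 34 show ?thesis
        by (intro image_eqI[of _ _ 3]) auto
    next
      case False
      with i show ?thesis by blast
    qed
  qed
  then have "card F \<le> card ({3..n} - {4})"
    by (meson card_image_le card_mono finite_Diff finite_atLeastAtMost finite_imageI le_trans)
  also have "\<dots> < card (x ` {3..n})"
    using assms(1,2) by (simp add: card_image card_Diff_singleton)
  finally have "\<not> x ` {3..n} \<subseteq> F"
    using card_mono[of F "x ` {3..n}"] by (auto simp: F_def)
  then obtain c where c: "c \<notin> F"
    by blast
  have "a * x i + b * y i + c \<noteq> 0" if "i \<in> {3..n}" for i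
  proof
    assume "a * x i + b * y i + c = 0"
    then have "c = - (a * x i + b * y i)"
      by (subst eq_neg_iff_add_eq_0) (subst add.commute)
    with that c show False
      by (auto simp: F_def)
  qed
  \<comment> \<open>Point \<open>3\<close> is the origin, where the affine form takes the value
    \<open>c\<close>.\<close>
  moreover from this[of 3] have "c \<noteq> 0"
    using assms(1,4,5) by simp
  ultimately show ?thesis
    using that[of a b c] 4 by (simp add: ab)
qed

section \<open>Coordinates from a representation\<close>

text \<open>There is the edge \<open>{1, 2}\<close> and two edges at each of the other
  \<open>n - 2\<close> vertices, which adds up to the prescribed rank.\<close>

lemma card_edges_meeting_1_2:
  assumes "n \<ge> 2"
  shows "card (nsets {1..n} 2 - nsets {3..n} 2) \<le> 2 * n - 3"
proof -
  let ?S = "insert {1, 2} ((\<lambda>k. {1, k}) ` {3..n} \<union> (\<lambda>k. {2, k}) ` {3..n})"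
  have "nsets {1..n} 2 - nsets {3..n} 2 \<subseteq> ?S"
  proof
    fix e assume e: "e \<in> nsets {1..n} 2 - nsets {3..n} 2"
    then obtain i j where "e = {i, j}" "i < j" "i \<in> {1..n}" "j \<in> {1..n}"
      using edge_cases[of e "{1..n}"] by blast
    moreover from this e have "i = 1 \<or> i = 2"
      by (auto simp: doubleton_mem_nsets_2)
    ultimately show "e \<in> ?S"
      by (cases "j = 2") auto
  qed
  then have "card (nsets {1..n} 2 - nsets {3..n} 2) \<le> card ?S"
    by (intro card_mono) auto
  also have "\<dots> \<le> Suc (card ((\<lambda>k. {1, k}) ` {3..n} \<union> (\<lambda>k. {2, k}) ` {3..n}))"
    by (simp add: card_insert_if)
  also have "\<dots> \<le> Suc (card ((\<lambda>k. {1, k}) ` {3..n}) + card ((\<lambda>k. {2, k}) ` {3..n}))"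
    by (simp add: card_Un_le)
  also have "\<dots> \<le> Suc (card {3..n} + card {3..n})"
    by (intro Suc_le_mono[THEN iffD2] add_mono card_image_le) auto
  also have "\<dots> \<le> 2 * n - 3"
    using assms by simp
  finally show ?thesis .
qed

text \<open>All these circuits share the edge \<open>{1, 2}\<close>. Normalising there removes the
  free scalar of each dependency and makes the coefficients for different \<open>e\<close>
  comparable.\<close>

lemma fundamental_circuit_coefficients:
  fixes A :: "'r \<Rightarrow> nat set \<Rightarrow> 'f::field"
  assumes "abstract_2_rigidity_matroid n \<I>" "\<I> = column_matroid R (nsets {1..n} 2) A"
  shows "\<exists>\<omega>. \<forall>e\<in>nsets {3..n} 2. dependency R (nsets {1..n} 2) A (\<omega> e)
    \<and> (\<forall>f. \<omega> e f \<noteq> 0 \<longleftrightarrow> f \<in> nsets ({1, 2} \<union> e) 2) \<and> \<omega> e {1, 2} = 1"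
proof -
  interpret abstract_2_rigidity_matroid n \<I> by fact
  have "\<exists>c. dependency R (nsets {1..n} 2) A c \<and> (\<forall>f. c f \<noteq> 0 \<longleftrightarrow> f \<in> nsets ({1, 2} \<union> e) 2)
      \<and> c {1, 2} = 1" if e: "e \<in> nsets {3..n} 2" for e
  proof -
    from e obtain i j where "e = {i, j}" "i < j" "i \<in> {3..n}" "j \<in> {3..n}"
      by (rule edge_cases)
    then have "{1, 2} \<union> e \<subseteq> {1..n}" "card ({1, 2} \<union> e) = 4"
      by auto
    from circuit_dependency[OF matroid_axioms assms(2) K4_circuit[OF this]]
    obtain c where c: "dependency R (nsets {1..n} 2) A c"
      "\<And>f. c f \<noteq> 0 \<longleftrightarrow> f \<in> nsets ({1, 2} \<union> e) 2"
      by blast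
    have "c {1, 2} \<noteq> 0"
      by (simp add: c(2) doubleton_mem_nsets_2)
    then show ?thesis
      using dependency_scale[OF c(1), of "1 / c {1, 2}"] c(2)
      by (intro exI[of _ "\<lambda>f. 1 / c {1, 2} * c f"]) simp
  qed
  then have "\<forall>e\<in>nsets {3..n} 2. \<exists>c. dependency R (nsets {1..n} 2) A c
      \<and> (\<forall>f. c f \<noteq> 0 \<longleftrightarrow> f \<in> nsets ({1, 2} \<union> e) 2) \<and> c {1, 2} = 1"
    by blast
  from bchoice[OF this] show ?thesis .
qed

text \<open>The circuit on \<open>{w, 3, j, k}\<close> has three edges outside the basis, so it is a
  combination of three fundamental dependencies. It misses \<open>u\<close>, so this combination
  vanishes at \<open>{1, 2}\<close>, \<open>{u, 3}\<close> and \<open>{u, j}\<close>. Eliminating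
  its coefficients from the three equations gives the relation.\<close>

lemma fundamental_circuit_relation:
  fixes A :: "'r \<Rightarrow> nat set \<Rightarrow> 'f::field"
  assumes M: "abstract_2_rigidity_matroid n \<I>" "\<I> = column_matroid R (nsets {1..n} 2) A"
    and ind: "columns_independent R A (nsets {1..n} 2 - nsets {3..n} 2)"
    and \<omega>: "\<And>e. e \<in> nsets {3..n} 2 \<Longrightarrow> dependency R (nsets {1..n} 2) A (\<omega> e)"
      "\<And>e f. e \<in> nsets {3..n} 2 \<Longrightarrow> \<omega> e f \<noteq> 0 \<longleftrightarrow> f \<in> nsets ({1, 2} \<union> e) 2"
      "\<And>e. e \<in> nsets {3..n} 2 \<Longrightarrow> \<omega> e {1, 2} = 1"
    and uw: "{u, w} = {1, 2}"
    and jk: "j \<in> {3..n} - {3}" "k \<in> {3..n} - {3}" "j \<noteq> k"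
  shows "\<omega> {3, j} {u, 3} / \<omega> {3, k} {u, 3} + \<omega> {j, 3} {u, j} / \<omega> {j, k} {u, j} = 1"
proof -
  interpret abstract_2_rigidity_matroid n \<I> by fact
  let ?E = "nsets {1..n} 2"
  have uw': "u \<noteq> w" "u \<in> {1, 2}" "w \<in> {1, 2}"
    using uw by (auto simp: doubleton_eq_iff)
  have 3: "3 \<in> {3..n}"
    using jk by auto
  have "{w, 3, j, k} \<subseteq> {1..n}" "card {w, 3, j, k} = 4"
    using uw' jk by (auto simp: card_insert_if)
  from circuit_dependency[OF matroid_axioms M(2) K4_circuit[OF this]]
  obtain d where d: "dependency R ?E A d" "\<And>f. d f \<noteq> 0 \<longleftrightarrow> f \<in> nsets {w, 3, j, k} 2"
    by blast
  have supp: "\<omega> {a, b} {s, t} \<noteq> 0 \<longleftrightarrow> s \<noteq> t \<and> s \<in> {1, 2, a, b} \<and> t \<in> {1, 2, a, b}"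
    if "a \<in> {3..n}" "b \<in> {3..n}" "a \<noteq> b" for a b s t
  proof -
    have "{a, b} \<in> nsets {3..n} 2" "{1, 2} \<union> {a, b} = {1, 2, a, b}"
      using that by (auto simp: doubleton_mem_nsets_2)
    then show ?thesis
      using \<omega>(2)[of "{a, b}" "{s, t}"] by (simp only: doubleton_mem_nsets_2 simp_thms)
  qed
  have dsupp: "d {s, t} \<noteq> 0 \<longleftrightarrow> s \<noteq> t \<and> s \<in> {w, 3, j, k} \<and> t \<in> {w, 3, j, k}" for s t
    using d(2)[of "{s, t}"] by (simp only: doubleton_mem_nsets_2)
  have J: "j \<in> {3..n}" "k \<in> {3..n}"
    using jk by auto
  have ne: "3 \<notin> {1, 2, j, k}" "j \<notin> {1, 2, 3, k}" "k \<notin> {1, 2, 3, j}" "u \<notin> {w, 3, j, k}"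
    using uw' jk by auto
  have nz: "\<omega> {3, j} {3, j} \<noteq> 0" "\<omega> {3, k} {3, k} \<noteq> 0" "\<omega> {j, k} {j, k} \<noteq> 0"
    using supp[OF 3 J(1), of 3 j] supp[OF 3 J(2), of 3 k] supp[OF J jk(3), of j k] ne by blast+
  have z: "\<omega> {3, j} {3, k} = 0" "\<omega> {3, j} {j, k} = 0" "\<omega> {3, k} {3, j} = 0"
    "\<omega> {3, k} {j, k} = 0" "\<omega> {j, k} {3, j} = 0" "\<omega> {j, k} {3, k} = 0"
    using supp[OF 3 J(1), of 3 k] supp[OF 3 J(1), of j k] supp[OF 3 J(2), of 3 j]
      supp[OF 3 J(2), of j k] supp[OF J jk(3), of 3 j] supp[OF J jk(3), of 3 k] ne by blast+
  \<comment> \<open>The scalars that make the combination agree with \<open>d\<close> on the three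
    edges outside the basis.\<close>
  define a b c where abc: "a = d {3, j} / \<omega> {3, j} {3, j}" "b = d {3, k} / \<omega> {3, k} {3, k}"
    "c = d {j, k} / \<omega> {j, k} {j, k}"
  have edges: "{3, j} \<in> nsets {3..n} 2" "{3, k} \<in> nsets {3..n} 2" "{j, k} \<in> nsets {3..n} 2"
    using 3 jk by (auto simp: doubleton_mem_nsets_2)
  define D where "D f = a * \<omega> {3, j} f + b * \<omega> {3, k} f + c * \<omega> {j, k} f - d f" for f
  have depD: "dependency R ?E A D"
    unfolding D_def using edges by (intro dependency_diff dependency_add dependency_scale d(1) \<omega>(1))
  have "D f = 0" if f: "f \<in> ?E - (?E - nsets {3..n} 2)" for f
  proof -
    from f have "f \<in> nsets {3..n} 2" by blast
    then obtain s t where st: "f = {s, t}" "s < t" "s \<in> {3..n}" "t \<in> {3..n}"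
      by (rule edge_cases)
    consider "f = {3, j}" | "f = {3, k}" | "f = {j, k}"
      | "f \<noteq> {3, j}" "f \<noteq> {3, k}" "f \<noteq> {j, k}" by blast
    then show ?thesis
    proof cases
      case 4
      have pair: "{s, t} = {p, q}" if "s \<in> {p, q}" "t \<in> {p, q}" for p q
        using that st(2) by auto
      have out: "s \<notin> {1, 2}" "t \<notin> {1, 2}" "s \<noteq> w" "t \<noteq> w"
        using st(3,4) uw'(3) by auto
      have no: "\<not> (s \<in> {3, j} \<and> t \<in> {3, j})" "\<not> (s \<in> {3, k} \<and> t \<in> {3, k})"
        "\<not> (s \<in> {j, k} \<and> t \<in> {j, k})"
        using 4 pair unfolding st(1) by blast+
      have "\<not> (s \<in> {3, j, k} \<and> t \<in> {3, j, k})"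
        using no by blast
      then have "d f = 0"
        unfolding st(1) using dsupp[of s t] out by blast
      moreover have "\<omega> {3, j} f = 0" "\<omega> {3, k} f = 0" "\<omega> {j, k} f = 0"
        unfolding st(1) using supp[OF 3 J(1), of s t] supp[OF 3 J(2), of s t]
          supp[OF J jk(3), of s t] no out ne by blast+
      ultimately show ?thesis
        by (simp add: D_def)
    qed (use nz z in \<open>simp_all add: D_def abc\<close>)
  qed
  with depD have D: "D f = 0" for f
    by (rule dependency_eq_0[OF finite_ground Diff_subset ind])
  \<comment> \<open>All three edges contain \<open>u\<close>, since \<open>{1, 2}\<close> is
    \<open>{u, w}\<close>.\<close>
  have d0: "d {1, 2} = 0" "d {u, 3} = 0" "d {u, j} = 0"
    unfolding uw[symmetric] using dsupp[of u w] dsupp[of u 3] dsupp[of u j] ne by blast+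
  have \<omega>0: "\<omega> {j, k} {u, 3} = 0" "\<omega> {3, k} {u, j} = 0"
    using supp[OF J jk(3), of u 3] supp[OF 3 J(2), of u j] ne by blast+
  have rel: "a + b + c = 0" "a * \<omega> {3, j} {u, 3} + b * \<omega> {3, k} {u, 3} = 0"
    "a * \<omega> {3, j} {u, j} + c * \<omega> {j, k} {u, j} = 0"
    using D[of "{1, 2}"] D[of "{u, 3}"] D[of "{u, j}"] unfolding D_def d0 \<omega>0 edges[THEN \<omega>(3)]
    by simp_all
  have nz': "\<omega> {3, k} {u, 3} \<noteq> 0" "\<omega> {j, k} {u, j} \<noteq> 0"
    using supp[OF 3 J(2), of u 3] supp[OF J jk(3), of u j] ne uw'(2) by blast+
  have "a \<noteq> 0"
    using dsupp[of 3 j] nz ne by (simp only: abc divide_eq_0_iff) blast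
  have b: "a * (\<omega> {3, j} {u, 3} / \<omega> {3, k} {u, 3}) = - b"
    using rel(2) nz'(1) by (simp add: add_eq_0_iff2 field_simps)
  have c: "a * (\<omega> {3, j} {u, j} / \<omega> {j, k} {u, j}) = - c"
    using rel(3) nz'(2) by (simp add: add_eq_0_iff2 field_simps)
  \<comment> \<open>The two quotients are \<open>- b / a\<close> and \<open>- c / a\<close>, and
    \<open>a + b + c = 0\<close> makes their sum \<open>1\<close>.\<close>
  have "a * (\<omega> {3, j} {u, 3} / \<omega> {3, k} {u, 3} + \<omega> {3, j} {u, j} / \<omega> {j, k} {u, j}) = - b + - c"
    by (simp only: distrib_left b c)
  also have "\<dots> = a * 1"
    using rel(1) by algebra
  finally show ?thesis
    using \<open>a \<noteq> 0\<close> by (simp add: insert_commute)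
qed

lemma edges_of_K4:
  assumes "f \<in> nsets {1, 2, i, j} 2" "(3::nat) \<le> i" "i < j"
  shows "f = {1, 2} \<or> f = {1, i} \<or> f = {1, j} \<or> f = {2, i} \<or> f = {2, j} \<or> f = {i, j}"
proof -
  from assms(1) obtain k l where "f = {k, l}" "k < l" "k \<in> {1, 2, i, j}" "l \<in> {1, 2, i, j}"
    by (rule edge_cases)
  with assms(2,3) show ?thesis
    by auto
qed

theorem theorem1p5:
  fixes n :: nat and \<I> :: "nat set set set"
  assumes "n \<ge> 4"
    and "abstract_2_rigidity_matroid n \<I>"
    and "representable_over TYPE('f::field) (nsets {1..n} 2) \<I>"
  shows "\<exists>p :: nat \<Rightarrow> 'f \<times> 'f.
    \<I> = column_matroid (rigidity_rows n) (nsets {1..n} 2) (rigidity_matrix p)"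
proof -
  interpret abstract_2_rigidity_matroid n \<I> by fact
  let ?E = "nsets {1..n} 2"
  let ?V = "nsets {3..n} 2"
  let ?B = "?E - ?V"

  \<comment> \<open>Fundamental dependencies over the basis \<open>?B\<close>\<close>
  from assms(3) obtain m and A :: "nat \<Rightarrow> nat set \<Rightarrow> 'f" where A: "\<I> = column_matroid {..<m} ?E A"
    unfolding representable_over_def by blast
  from fundamental_circuit_coefficients[OF assms(2) A] obtain \<omega> where \<omega>: "\<And>e. e \<in> ?V \<Longrightarrow> dependency {..<m} ?E A (\<omega> e)"
    "\<And>e f. e \<in> ?V \<Longrightarrow> \<omega> e f \<noteq> 0 \<longleftrightarrow> f \<in> nsets ({1, 2} \<union> e) 2"
    "\<And>e. e \<in> ?V \<Longrightarrow> \<omega> e {1, 2} = 1"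
    by blast
  have supp: "\<omega> {i, j} {k, l} \<noteq> 0 \<longleftrightarrow> k \<noteq> l \<and> k \<in> {1, 2, i, j} \<and> l \<in> {1, 2, i, j}"
    if "i \<in> {3..n}" "j \<in> {3..n}" "i \<noteq> j" for i j k l
  proof -
    have "{i, j} \<in> ?V" "{1, 2} \<union> {i, j} = {1, 2, i, j}"
      using that by (auto simp: doubleton_mem_nsets_2)
    then show ?thesis
      using \<omega>(2)[of "{i, j}" "{k, l}"] by (simp only: doubleton_mem_nsets_2 simp_thms)
  qed
  have nonbasis: "e \<in> ?V" if "e \<in> ?E - ?B" for e
    using that by blast
  have \<omega>_diag: "\<omega> e e \<noteq> 0" if e: "e \<in> ?V" for e
  proof -
    have "e \<in> nsets ({1, 2} \<union> e) 2"
      using e by (auto simp: nsets_def)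
    with \<omega>(2)[OF e] show ?thesis by blast
  qed
  have \<omega>_off: "\<omega> e f = 0" if e: "e \<in> ?V" and f: "f \<in> ?V" and "e \<noteq> f" for e f
  proof (rule ccontr)
    assume "\<omega> e f \<noteq> 0"
    then have "f \<subseteq> {1, 2} \<union> e"
      using \<omega>(2)[OF e] by (auto simp: nsets_def)
    with f have "f \<subseteq> e"
      by (fastforce simp: nsets_def)
    with e f have "f = e"
      by (intro card_subset_eq) (auto simp: nsets_def)
    with \<open>e \<noteq> f\<close> show False by simp
  qed
  have "card ?B \<le> rank ?E"
    unfolding rank_eq using assms(1) by (intro card_edges_meeting_1_2) simp
  \<comment> \<open>The \<open>\<omega> e\<close> show that \<open>?B\<close> spans, so the bound on
    its size makes it a basis.\<close>
  then have indA: "columns_independent {..<m} A ?B"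
    by (rule spanning_columns_independent[OF matroid_axioms A Diff_subset, where \<omega> = \<omega>])
      (intro \<omega>(1) \<omega>_diag \<omega>_off nonbasis; assumption)+

  \<comment> \<open>Coordinates of the vertices from \<open>3\<close> on\<close>
  have coords: "\<exists>x t. x 3 = 0 \<and> (\<forall>i\<in>{3..n}. t i \<noteq> 0) \<and>
      (\<forall>i\<in>{3..n}. \<forall>j\<in>{3..n}. i \<noteq> j \<longrightarrow> t i = \<omega> {i, j} {u, i} * (x j - x i))"
    if uw: "{u, w} = {1, 2}" for u w
  proof -
    have u: "u \<in> {1, 2}"
      using uw by blast
    have "\<omega> {i, j} {u, i} \<noteq> 0" if "i \<in> {3..n}" "j \<in> {3..n}" "i \<noteq> j" for i j
    proof -
      have "u \<noteq> i"
        using u that by auto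
      with u supp[OF that, of u i] show ?thesis by blast
    qed
    moreover have "3 \<in> {3..n}"
      using assms(1) by simp
    moreover have "\<omega> {3, j} {u, 3} / \<omega> {3, k} {u, 3} + \<omega> {j, 3} {u, j} / \<omega> {j, k} {u, j} = 1"
      if "j \<in> {3..n} - {3}" "k \<in> {3..n} - {3}" "j \<noteq> k" for j k
      using \<omega> uw that by (rule fundamental_circuit_relation[OF assms(2) A indA])
    ultimately show ?thesis
      by (intro reciprocal_differences[of 3 "{3..n}" "\<lambda>i j. \<omega> {i, j} {u, i}"])
  qed
  \<comment> \<open>The choice \<open>u = 2\<close> yields \<open>x\<close> and \<open>t\<close>,
    the choice \<open>u = 1\<close> yields \<open>y\<close> and \<open>s\<close>.\<close>
  have "{2, 1} = {1, 2 :: nat}"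
    by auto
  from coords[OF this] obtain x t where x: "x 3 = 0" "\<And>i. i \<in> {3..n} \<Longrightarrow> t i \<noteq> 0"
    "\<And>i j. i \<in> {3..n} \<Longrightarrow> j \<in> {3..n} \<Longrightarrow> i \<noteq> j \<Longrightarrow> t i = \<omega> {i, j} {2, i} * (x j - x i)"
    by blast
  from coords[OF refl] obtain y s where y: "y 3 = 0" "\<And>i. i \<in> {3..n} \<Longrightarrow> s i \<noteq> 0"
    "\<And>i j. i \<in> {3..n} \<Longrightarrow> j \<in> {3..n} \<Longrightarrow> i \<noteq> j \<Longrightarrow> s i = \<omega> {i, j} {1, i} * (y j - y i)"
    by blast
  \<comment> \<open>Equal coordinates at two vertices would force \<open>t i = 0\<close> or
    \<open>s i = 0\<close>.\<close>
  have inj: "inj_on x {3..n}" "inj_on y {3..n}"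
    using x(2,3) y(2,3) by (auto simp: inj_on_def) (metis diff_self mult_zero_right)+

  \<comment> \<open>Affine points and column scaling\<close>
  obtain a b c where abc: "a \<noteq> 0" "b \<noteq> 0" "c \<noteq> 0" "\<And>i. i \<in> {3..n} \<Longrightarrow> a * x i + b * y i + c \<noteq> 0"
    using line_avoiding_points[OF assms(1) inj x(1) y(1)] by blast
  define h where "h k = a * x k + b * y k + c" for k
  have h: "h i \<noteq> 0" if "i \<in> {3..n}" for i
    using abc(4)[OF that] by (simp add: h_def)
  \<comment> \<open>The projective map \<open>(X : Y : Z)\<close> to
    \<open>(X : Y : a * X + b * Y + c * Z)\<close> applied to \<open>(1 : 0 : 0)\<close>,
    \<open>(0 : 1 : 0)\<close> and \<open>(x k : y k : 1)\<close>. The last coordinates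
    \<open>a\<close>, \<open>b\<close> and \<open>h k\<close> are nonzero, so every image is an
    affine point.\<close>
  define p where "p k = (if k = 1 then (1 / a, 0) else if k = 2 then (0, 1 / b)
    else (x k / h k, y k / h k))" for k
  \<comment> \<open>The scaling that turns \<open>\<omega> {i, j}\<close> into the stress of \<open>p\<close> on \<open>{1, 2, i, j}\<close>, divided by
    \<open>(x j - x i) * (y j - y i)\<close>. The values at \<open>{1, i}\<close> and \<open>{2, i}\<close> must not depend on \<open>j\<close>, which
    is where the formulas for \<open>s\<close> and \<open>t\<close> enter.\<close>
  define \<mu> where "\<mu> f = (let i = Min f; j = Max f in
    if 3 \<le> i then - (h i * h j) / ((x j - x i) * (y j - y i) * \<omega> f f)
    else if j = 2 then a * b
    else if i = 1 then a * h j / s j else b * h j / t j)" for f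
  have \<mu>_edge: "\<mu> {i, j} = (if 3 \<le> i then - (h i * h j) / ((x j - x i) * (y j - y i) * \<omega> {i, j} {i, j})
    else if j = 2 then a * b
    else if i = 1 then a * h j / s j else b * h j / t j)" if "i < j" for i j
    using that by (simp add: \<mu>_def Let_def min_def max_def)
  have \<mu>_nz: "\<mu> e \<noteq> 0" if "e \<in> ?E" for e
  proof -
    from that obtain i j where ij: "e = {i, j}" "i < j" "i \<in> {1..n}" "j \<in> {1..n}"
      by (rule edge_cases)
    show ?thesis
    proof (cases "3 \<le> i")
      case True
      then have i: "i \<in> {3..n}" "j \<in> {3..n}"
        using ij by auto
      then have "x j \<noteq> x i" "y j \<noteq> y i"
        using inj ij(2) by (auto dest: inj_onD)
      moreover have "e \<in> ?V"
        using i ij by (simp add: doubleton_mem_nsets_2)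
      ultimately show ?thesis
        using True h[OF i(1)] h[OF i(2)] \<omega>_diag[of e] unfolding ij(1) \<mu>_edge[OF ij(2)] by simp
    next
      case False
      show ?thesis
      proof (cases "j = 2")
        case True
        with False abc show ?thesis
          unfolding ij(1) \<mu>_edge[OF ij(2)] by simp
      next
        case j: False
        then have "j \<in> {3..n}"
          using ij by auto
        with False j h x(2) y(2) abc show ?thesis
          unfolding ij(1) \<mu>_edge[OF ij(2)] by simp
      qed
    qed
  qed

  \<comment> \<open>Stresses of the scaled rigidity matrix\<close>
  let ?R = "\<lambda>r e. \<mu> e * rigidity_matrix p r e"
  have dep: "dependency (rigidity_rows n) ?E ?R (\<omega> e)" if e: "e \<in> ?V" for e
  proof -
    from e obtain i j where ij: "e = {i, j}" "i < j" "i \<in> {3..n}" "j \<in> {3..n}"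
      by (rule edge_cases)
    let ?T = "{1, 2, i, j}"
    define X Y where XY: "X = x j - x i" "Y = y j - y i"
    have XY0: "X \<noteq> 0" "Y \<noteq> 0"
      using inj ij by (auto simp: XY dest: inj_onD)
    have T: "{1, 2} \<union> e = ?T"
      using ij(1) by auto
    have TE: "nsets ?T 2 \<subseteq> ?E"
      using ij by (intro nsets_mono) auto
    \<comment> \<open>the coefficients of the affine dependency of the four points of \<open>?T\<close>\<close>
    define \<alpha> where "\<alpha> k = (if k = 1 then a * X else if k = 2 then b * Y
      else if k = i then h i else - h j)" for k
    have \<alpha>: "\<alpha> 1 = a * X" "\<alpha> 2 = b * Y" "\<alpha> i = h i" "\<alpha> j = - h j"
      using ij by (auto simp: \<alpha>_def)
    have p: "p 1 = (1 / a, 0)" "p 2 = (0, 1 / b)" "p i = (x i / h i, y i / h i)"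
      "p j = (x j / h j, y j / h j)"
      using ij by (auto simp: p_def)
    have sumT: "(\<Sum>k\<in>?T. g k) = g 1 + (g 2 + (g i + g j))" for g :: "nat \<Rightarrow> 'f"
      using ij by simp
    have prod2: "(\<Prod>k\<in>{u, v}. \<alpha> k) = \<alpha> u * \<alpha> v" if "u < v" for u v
      using that by simp
    \<comment> \<open>In homogeneous coordinates, \<open>X * (1, 0, 0) + Y * (0, 1, 0) + (x i, y i,
      1) - (x j, y j, 1) = 0\<close>. Multiplying each coefficient by the last coordinate of the
      image point gives \<open>\<alpha>\<close>.\<close>
    have "(\<Sum>k\<in>?T. \<alpha> k) = 0"
      unfolding sumT \<alpha> by (simp add: h_def XY algebra_simps)
    moreover have "(\<Sum>k\<in>?T. \<alpha> k * fst (p k)) = 0" "(\<Sum>k\<in>?T. \<alpha> k * snd (p k)) = 0"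
      unfolding sumT \<alpha> p using abc h ij by (simp_all add: XY)
    ultimately have stress: "(\<Sum>f\<in>nsets ?T 2. (\<Prod>k\<in>f. \<alpha> k) * rigidity_matrix p r f) = 0" for r
      by (intro affine_dependency_stress) auto
    \<comment> \<open>The factor is fixed by the edge \<open>{1, 2}\<close>, where the left side is
      \<open>a * b\<close> and the product is \<open>a * X * (b * Y)\<close>.\<close>
    have w: "\<omega> e f * \<mu> f = 1 / (X * Y) * (\<Prod>k\<in>f. \<alpha> k)" if f: "f \<in> nsets ?T 2" for f
    proof -
      have i3: "3 \<le> i" "3 \<le> j" "1 < i" "2 < i" "1 < j" "2 < j" "i \<noteq> j" "j \<noteq> i"
        "(1::nat) < 2"
        using ij by auto
      have ji: "{j, i} = {i, j}"
        by auto
      \<comment> \<open>Exchanging \<open>i\<close> and \<open>j\<close> negates \<open>X\<close>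
        and \<open>Y\<close>, hence the signs at \<open>j\<close>.\<close>
      have st: "s i = \<omega> e {1, i} * Y" "s j = - \<omega> e {1, j} * Y"
        "t i = \<omega> e {2, i} * X" "t j = - \<omega> e {2, j} * X"
        using x(3)[OF ij(3,4)] x(3)[OF ij(4,3)] y(3)[OF ij(3,4)] y(3)[OF ij(4,3)] i3
        unfolding ij(1) XY ji by (simp_all add: algebra_simps)
      then have nz: "\<omega> e {1, i} \<noteq> 0" "\<omega> e {1, j} \<noteq> 0" "\<omega> e {2, i} \<noteq> 0" "\<omega> e {2, j} \<noteq> 0"
        using x(2)[OF ij(3)] x(2)[OF ij(4)] y(2)[OF ij(3)] y(2)[OF ij(4)] by auto
      have mu: "\<mu> {1, 2} = a * b" "\<mu> {1, i} = a * h i / s i" "\<mu> {1, j} = a * h j / s j"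
        "\<mu> {2, i} = b * h i / t i" "\<mu> {2, j} = b * h j / t j"
        "\<mu> e = - (h i * h j) / (X * Y * \<omega> e e)"
        using i3 by (simp_all add: \<mu>_edge XY ij(1,2))
      from edges_of_K4[OF f i3(1) ij(2)]
      consider "f = {1, 2}" | "f = {1, i}" | "f = {1, j}" | "f = {2, i}" | "f = {2, j}" | "f = e"
        unfolding ij(1) by blast
      then show ?thesis
      proof cases
        case 1
        show ?thesis
          unfolding 1 mu \<omega>(3)[OF e] prod2[OF i3(9)] \<alpha> using XY0 by simp
      next
        case 2
        show ?thesis
          unfolding 2 mu prod2[OF i3(3)] \<alpha> st using XY0 nz by (simp add: field_simps)
      next
        case 3
        show ?thesis
          unfolding 3 mu prod2[OF i3(5)] \<alpha> st using XY0 nz by (simp add: field_simps)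
      next
        case 4
        show ?thesis
          unfolding 4 mu prod2[OF i3(4)] \<alpha> st using XY0 nz by (simp add: field_simps)
      next
        case 5
        show ?thesis
          unfolding 5 mu prod2[OF i3(6)] \<alpha> st using XY0 nz by (simp add: field_simps)
      next
        case 6
        have "(\<Prod>k\<in>e. \<alpha> k) = \<alpha> i * \<alpha> j"
          unfolding ij(1) by (rule prod2[OF ij(2)])
        then show ?thesis
          unfolding 6 mu \<alpha> using XY0 \<omega>_diag[OF e] by (simp add: field_simps)
      qed
    qed
    have "(\<Sum>f\<in>?E. \<omega> e f * ?R r f) = 0" for r
    proof -
      have "(\<Sum>f\<in>?E. \<omega> e f * ?R r f) = (\<Sum>f\<in>nsets ?T 2. \<omega> e f * ?R r f)"
      proof (rule sum.mono_neutral_right[OF finite_ground TE], rule ballI)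
        fix f assume "f \<in> ?E - nsets ?T 2"
        then have "\<omega> e f = 0"
          using \<omega>(2)[OF e, of f] unfolding T by blast
        then show "\<omega> e f * ?R r f = 0" by simp
      qed
      also have "\<dots> = (\<Sum>f\<in>nsets ?T 2. 1 / (X * Y) * ((\<Prod>k\<in>f. \<alpha> k) * rigidity_matrix p r f))"
        by (intro sum.cong refl) (simp only: w mult.assoc[symmetric])
      also have "\<dots> = 0"
        by (simp only: sum_distrib_left[symmetric] stress mult_zero_right)
      finally show ?thesis .
    qed
    moreover have "\<omega> e f = 0" if "f \<notin> ?E" for f
      using \<omega>(2)[OF e, of f] TE that unfolding T by blast
    ultimately show ?thesis
      by (simp only: dependency_def) blast
  qed

  \<comment> \<open>Equality of the two matroids\<close>
  have "a * fst (p k) + b * snd (p k) \<noteq> 1" if k: "k \<in> {3..n}" for k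
  proof -
    have "p k = (x k / h k, y k / h k)"
      using k by (simp add: p_def)
    \<comment> \<open>The value is \<open>1 - c / h k\<close>, so \<open>c \<noteq> 0\<close> keeps
      \<open>p k\<close> off the line through \<open>p 1\<close> and \<open>p 2\<close>.\<close>
    then have "a * fst (p k) + b * snd (p k) = (h k - c) / h k"
      by (simp add: h_def add_divide_distrib)
    then show ?thesis
      using abc(3) by (simp only: divide_eq_1_iff) simp
  qed
  then have "columns_independent (rigidity_rows n) (rigidity_matrix p) ?B"
    using assms(1) abc by (intro columns_independent_rigidity_matrix[of n a b]) (auto simp: p_def)
  then have "columns_independent (rigidity_rows n) ?R ?B"
    using \<mu>_nz by (subst columns_independent_scale) auto
  \<comment> \<open>\<open>A\<close> and the scaled matrix share the basis \<open>?B\<close> and the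
    fundamental dependencies \<open>\<omega> e\<close>.\<close>
  from column_matroid_eqI[OF finite_ground Diff_subset indA this, of \<omega>]
  have "\<I> = column_matroid (rigidity_rows n) ?E ?R"
    using \<omega>(1) dep \<omega>_diag \<omega>_off nonbasis unfolding A by blast
  also have "\<dots> = column_matroid (rigidity_rows n) ?E (rigidity_matrix p)"
    using \<mu>_nz by (rule column_matroid_scale)
  finally show ?thesis
    by blast
qed

end
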